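(* Let $0\le r\le N_t-1$ and assume $\bm K_{\ell,r}\succ\bm 0$ for every cell $\ell=1,\dots,L$. Under the bijective change of coordinates $\widetilde{\bm V}_{\ell k}=\bm K_{\ell,r}^{1/2}\bm V_{\ell k}$, maximizing the Spectral-NFP surrogate $f_{s,r}(\underline{\bm V}\mid\underline{\bm V}^{(t)})$ over $\mathcal C$ is equivalent to one unit-step Euclidean projected-gradient-ascent step on $\widetilde f_q$ over $\widetilde{\mathcal C}_r$; that is, $\underline{\bm V}^{(t+1)}$ maximizes $f_{s,r}(\cdot\mid\underline{\bm V}^{(t)})$ over $\mathcal C$ if and only if $\widetilde{\bm V}^{(t+1)}_{\ell k}=\bm K_{\ell,r}^{1/2}\bm V^{(t+1)}_{\ell k}$ satisfies $$\underline{\widetilde{\bm V}}^{(t+1)}=\mathcal P_{\widetilde{\mathcal C}_r}\!\left(\underline{\widetilde{\bm V}}^{(t)}+\frac{\partial\widetilde f_q}{\partial\underline{\widetilde{\bm V}}^{*}}\Big|_{\underline{\widetilde{\bm V}}^{(t)}}\right),\qquad \widetilde{\bm V}^{(t)}_{\ell k}=\bm K_{\ell,r}^{1/2}\bm V^{(t)}_{\ell k},$$ where the $(\ell,k)$ block of the argument of the projection equals $\bm K_{\ell,r}^{-1/2}\bm B^{(r)}_{\ell k}$.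
   Context: Fix $L$ cells with $K$ users each. For $\ell=1,\dots,L$, $k=1,\dots,K$, let $P_\ell\ge0$ be power budgets, and with fixed weights $w_{ij}\ge0$, channels $\bm H_{ij,\ell}\in\mathbb C^{N_r\times N_t}$, auxiliary variables $\bm Y_{ij}\in\mathbb C^{N_r\times d}$ and Hermitian positive semidefinite $\bm\Gamma_{ij}\in\mathbb C^{d\times d}$ let $$\bm\Lambda_{\ell k}=w_{\ell k}\bm H_{\ell k,\ell}^H\bm Y_{\ell k}(\bm I_d+\bm\Gamma_{\ell k}),\qquad \bm L_\ell=\sum_{i=1}^L\sum_{j=1}^Kw_{ij}\bm H_{ij,\ell}^H\bm Y_{ij}(\bm I_d+\bm\Gamma_{ij})\bm Y_{ij}^H\bm H_{ij,\ell}.$$ Let $\bm L_\ell=\bm U_\ell\,\mathrm{diag}(\lambda_{\ell,1},\dots,\lambda_{\ell,N_t})\bm U_\ell^H$ with $\bm U_\ell$ unitary, $\lambda_{\ell,1}\ge\cdots\ge\lambda_{\ell,N_t}\ge0$, and $$\bm K_{\ell,r}=\bm U_\ell\,\mathrm{diag}(\lambda_{\ell,1},\dots,\lambda_{\ell,r},\underbrace{\lambda_{\ell,r+1},\dots,\lambda_{\ell,r+1}}_{N_t-r})\bm U_\ell^H .$$ The feasible set is $\mathcal C=\{\underline{\bm V}=(\bm V_{\ell k})_{\ell,k}:\bm V_{\ell k}\in\mathbb C^{N_t\times d},\ \sum_{k}\|\bm V_{\ell k}\|_F^2\le P_\ell\ \text{for all }\ell\}$, and $\underline{\bm V}^{(t)}\in\mathcal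 C$ is the current iterate. The surrogate is $$f_{s,r}(\underline{\bm V}\mid\underline{\bm V}^{(t)})=\sum_{\ell,k}\big[2\operatorname{Re}\operatorname{tr}(\bm V_{\ell k}^H\bm B^{(r)}_{\ell k})-\operatorname{tr}(\bm V_{\ell k}^H\bm K_{\ell,r}\bm V_{\ell k})\big]+\mathrm{const},\quad \bm B^{(r)}_{\ell k}=\bm\Lambda_{\ell k}+(\bm K_{\ell,r}-\bm L_\ell)\bm V^{(t)}_{\ell k}.$$ The transmit objective, with auxiliary variables fixed, is $f_q(\underline{\bm V})=\sum_{\ell,k}[2\operatorname{Re}\operatorname{tr}(\bm V_{\ell k}^H\bm\Lambda_{\ell k})-\operatorname{tr}(\bm V_{\ell k}^H\bm L_\ell\bm V_{\ell k})]+\mathrm{const}$, and in transformed coordinates $$\widetilde f_q(\underline{\widetilde{\bm V}})=\sum_{\ell,k}\big[2\operatorname{Re}\operatorname{tr}(\widetilde{\bm V}_{\ell k}^H\bm K_{\ell,r}^{-1/2}\bm\Lambda_{\ell k})-\operatorname{tr}(\widetilde{\bm V}_{\ell k}^H\bm K_{\ell,r}^{-1/2}\bm L_\ell\bm K_{\ell,r}^{-1/2}\widetilde{\bm V}_{\ell k})\big]+\mathrm{const},$$ with transformed feasible set $\widetilde{\mathcal C}_r=\{\underline{\widetilde{\bm V}}:\sum_k\operatorname{tr}(\widetilde{\bm V}_{\ell k}^H\bm K_{\ell,r}^{-1}\widetilde{\bm V}_{\ell k})\le P_\ell\ \text{for all }\ell\}$. $\mathcal P_{\widetilde{\mathcal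 C}_r}$ is Euclidean (Frobenius-norm) projection onto $\widetilde{\mathcal C}_r$, applied jointly to all blocks. $\partial/\partial\widetilde{\bm V}^{*}_{\ell k}$ is the Wirtinger (conjugate) derivative, so that e.g. $\partial\,[2\operatorname{Re}\operatorname{tr}(\bm X^H\bm A)]/\partial\bm X^*=\bm A$ and $\partial\operatorname{tr}(\bm X^H\bm M\bm X)/\partial\bm X^*=\bm M\bm X$ for Hermitian $\bm M$. *)

theory Defs
  imports "HOL-Analysis.Analysis"
begin

text \<open>\<open>('m, 'n) cmat\<close> is the type of complex \<open>'m \<times> 'n\<close> matrices, the same type as \<open>complex^'n^'m\<close>.
  Its library norm, the Euclidean norm of the Euclidean row norms, is the Frobenius norm. Cells,
  users and matrix dimensions are finite (hence nonempty) index types \<open>'l\<close>, \<open>'k\<close>, \<open>'nt\<close>, \<open>'nr\<close>,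
  \<open>'d\<close>. Block \<open>(l,k)\<close> of a tuple \<open>V\<close> is \<open>V $ l $ k\<close>; the library norm of a tuple is again the
  joint Frobenius norm.\<close>

type_synonym ('m, 'n) cmat = "((complex, 'n) vec, 'm) vec"

type_synonym ('l, 'k, 'm, 'n) blocks = "((('m, 'n) cmat, 'k) vec, 'l) vec"

definition ctranspose :: "('m::finite, 'n::finite) cmat \<Rightarrow> ('n, 'm) cmat"  ("_\<^sup>H" [1000] 1000)
  where "A\<^sup>H = (\<chi> i j. cnj (A $ j $ i))"

definition hermitian :: "('n::finite, 'n) cmat \<Rightarrow> bool"
  where "hermitian A \<longleftrightarrow> A\<^sup>H = A"

definition unitary :: "('n::finite, 'n) cmat \<Rightarrow> bool"
  where "unitary U \<longleftrightarrow> U\<^sup>H ** U = mat 1 \<and> U ** U\<^sup>H = mat 1"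

definition quad_form :: "('n::finite, 'n) cmat \<Rightarrow> (complex, 'n) vec \<Rightarrow> complex"
  where "quad_form A x = (\<Sum>i\<in>UNIV. cnj (x $ i) * (A *v x) $ i)"

text \<open>Taking \<^const>\<open>Re\<close> loses nothing: the quadratic form of a Hermitian matrix is real. The same
  applies to the real parts of \<open>tr (V\<^sup>H M V)\<close> below.\<close>

definition psd :: "('n::finite, 'n) cmat \<Rightarrow> bool"
  where "psd A \<longleftrightarrow> hermitian A \<and> (\<forall>x. 0 \<le> Re (quad_form A x))"

definition pos_def :: "('n::finite, 'n) cmat \<Rightarrow> bool"
  where "pos_def A \<longleftrightarrow> hermitian A \<and> (\<forall>x. x \<noteq> 0 \<longrightarrow> 0 < Re (quad_form A x))"

definition psd_sqrt :: "('n::finite, 'n) cmat \<Rightarrow> ('n, 'n) cmat"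
  where "psd_sqrt A = (THE S. psd S \<and> S ** S = A)"

definition diag_mat :: "('n::finite \<Rightarrow> real) \<Rightarrow> ('n, 'n) cmat"
  where "diag_mat f = (\<chi> i j. if i = j then complex_of_real (f i) else 0)"

text \<open>One-based position of a row index in the order of the index type, so that eigenvalues can be
  listed as \<open>lam 1 \<ge> \<dots> \<ge> lam N\<close> with \<open>N = CARD('n)\<close>.\<close>

definition pos :: "'n::{finite,linorder} \<Rightarrow> nat"
  where "pos i = card {j. j \<le> i}"

definition eig_decomp ::
  "('n::{finite,linorder}, 'n) cmat \<Rightarrow> ('n, 'n) cmat \<Rightarrow> (nat \<Rightarrow> real) \<Rightarrow> bool"
  where "eig_decomp A U lam \<longleftrightarrow>
     unitary U \<and> A = U ** diag_mat (\<lambda>i. lam (pos i)) ** U\<^sup>H \<and>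
     antimono_on {1..CARD('n)} lam \<and> (\<forall>m\<in>{1..CARD('n)}. 0 \<le> lam m)"

definition K_mat ::
  "('n::{finite,linorder}, 'n) cmat \<Rightarrow> (nat \<Rightarrow> real) \<Rightarrow> nat \<Rightarrow> ('n, 'n) cmat"
  where "K_mat U lam r =
     U ** diag_mat (\<lambda>i. if pos i \<le> r then lam (pos i) else lam (r + 1)) ** U\<^sup>H"

text \<open>\<open>H i j l\<close> is the channel \<open>H_{ij,l}\<close>.\<close>

definition Lambda_mat ::
  "('l::finite \<Rightarrow> 'k::finite \<Rightarrow> real) \<Rightarrow> ('l \<Rightarrow> 'k \<Rightarrow> 'l \<Rightarrow> ('nr::finite, 'nt::finite) cmat) \<Rightarrow>
   ('l \<Rightarrow> 'k \<Rightarrow> ('nr, 'd::finite) cmat) \<Rightarrow>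
   ('l \<Rightarrow> 'k \<Rightarrow> ('d, 'd) cmat) \<Rightarrow> 'l \<Rightarrow> 'k \<Rightarrow> ('nt, 'd) cmat"
  where "Lambda_mat w H Y G l k = w l k *\<^sub>R ((H l k l)\<^sup>H ** Y l k ** (mat 1 + G l k))"

definition L_mat ::
  "('l::finite \<Rightarrow> 'k::finite \<Rightarrow> real) \<Rightarrow> ('l \<Rightarrow> 'k \<Rightarrow> 'l \<Rightarrow> ('nr::finite, 'nt::finite) cmat) \<Rightarrow>
   ('l \<Rightarrow> 'k \<Rightarrow> ('nr, 'd::finite) cmat) \<Rightarrow> ('l \<Rightarrow> 'k \<Rightarrow> ('d, 'd) cmat) \<Rightarrow> 'l \<Rightarrow> ('nt, 'nt) cmat"
  where "L_mat w H Y G l =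
     (\<Sum>i\<in>UNIV. \<Sum>j\<in>UNIV.
        w i j *\<^sub>R ((H i j l)\<^sup>H ** Y i j ** (mat 1 + G i j) ** (Y i j)\<^sup>H ** H i j l))"

definition feasible :: "('l::finite \<Rightarrow> real) \<Rightarrow> ('l, 'k::finite, 'nt::finite, 'd::finite) blocks set"
  where "feasible P = {V. \<forall>l. (\<Sum>k\<in>UNIV. (norm (V $ l $ k))\<^sup>2) \<le> P l}"

text \<open>In the following, \<open>Lam\<close>, \<open>L\<close> and \<open>K\<close> stand for the families \<open>\<Lambda>_{lk}\<close>, \<open>L_l\<close> and \<open>K_{l,r}\<close>
  (with \<open>r\<close> fixed), and \<open>c\<close> is an additive constant.\<close>

definition B_mat ::
  "('l::finite \<Rightarrow> 'k::finite \<Rightarrow> ('nt::finite, 'd::finite) cmat) \<Rightarrow>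
   ('l \<Rightarrow> ('nt, 'nt) cmat) \<Rightarrow> ('l \<Rightarrow> ('nt, 'nt) cmat) \<Rightarrow>
   ('l, 'k, 'nt, 'd) blocks \<Rightarrow> 'l \<Rightarrow> 'k \<Rightarrow> ('nt, 'd) cmat"
  where "B_mat Lam L K Vt l k = Lam l k + (K l - L l) ** (Vt $ l $ k)"

definition surrogate ::
  "('l::finite \<Rightarrow> 'k::finite \<Rightarrow> ('nt::finite, 'd::finite) cmat) \<Rightarrow>
   ('l \<Rightarrow> ('nt, 'nt) cmat) \<Rightarrow> ('l \<Rightarrow> ('nt, 'nt) cmat) \<Rightarrow> real \<Rightarrow>
   ('l, 'k, 'nt, 'd) blocks \<Rightarrow> ('l, 'k, 'nt, 'd) blocks \<Rightarrow> real"
  where "surrogate Lam L K c Vt V =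
     (\<Sum>l\<in>UNIV. \<Sum>k\<in>UNIV.
        2 * Re (trace ((V $ l $ k)\<^sup>H ** B_mat Lam L K Vt l k))
        - Re (trace ((V $ l $ k)\<^sup>H ** K l ** (V $ l $ k)))) + c"

definition transformed_objective ::
  "('l::finite \<Rightarrow> 'k::finite \<Rightarrow> ('nt::finite, 'd::finite) cmat) \<Rightarrow>
   ('l \<Rightarrow> ('nt, 'nt) cmat) \<Rightarrow> ('l \<Rightarrow> ('nt, 'nt) cmat) \<Rightarrow> real \<Rightarrow>
   ('l, 'k, 'nt, 'd) blocks \<Rightarrow> real"
  where "transformed_objective Lam L K c V =
     (\<Sum>l\<in>UNIV. \<Sum>k\<in>UNIV.
        2 * Re (trace ((V $ l $ k)\<^sup>H ** matrix_inv (psd_sqrt (K l)) ** Lam l k))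
        - Re (trace ((V $ l $ k)\<^sup>H **
            (matrix_inv (psd_sqrt (K l)) ** L l ** matrix_inv (psd_sqrt (K l))) ** (V $ l $ k)))) + c"

definition transformed_feasible ::
  "('l::finite \<Rightarrow> ('nt::finite, 'nt) cmat) \<Rightarrow> ('l \<Rightarrow> real) \<Rightarrow>
   ('l, 'k::finite, 'nt, 'd::finite) blocks set"
  where "transformed_feasible K P =
     {V. \<forall>l. (\<Sum>k\<in>UNIV. Re (trace ((V $ l $ k)\<^sup>H ** matrix_inv (K l) ** (V $ l $ k)))) \<le> P l}"

definition change_coord ::
  "('l::finite \<Rightarrow> ('nt::finite, 'nt) cmat) \<Rightarrow>
   ('l, 'k::finite, 'nt, 'd::finite) blocks \<Rightarrow> ('l, 'k, 'nt, 'd) blocks"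
  where "change_coord K V = (\<chi> l k. psd_sqrt (K l) ** (V $ l $ k))"

text \<open>The conjugate Wirtinger derivative \<open>\<partial>/\<partial>z\<^sup>* = (\<partial>/\<partial>x + \<i> \<partial>/\<partial>y) / 2\<close>, taken with respect to
  each complex entry \<open>z = x + \<i> y\<close> of the tuple.\<close>

definition entry_unit ::
  "'l::finite \<Rightarrow> 'k::finite \<Rightarrow> 'nt::finite \<Rightarrow> 'd::finite \<Rightarrow> complex \<Rightarrow> ('l, 'k, 'nt, 'd) blocks"
  where "entry_unit l k a b z = axis l (axis k (axis a (axis b z)))"

definition wirtinger_conj ::
  "(('l::finite, 'k::finite, 'nt::finite, 'd::finite) blocks \<Rightarrow> real) \<Rightarrow>
   ('l, 'k, 'nt, 'd) blocks \<Rightarrow> ('l, 'k, 'nt, 'd) blocks"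
  where "wirtinger_conj f V = (\<chi> l k a b.
     (complex_of_real (deriv (\<lambda>t::real. f (V + t *\<^sub>R entry_unit l k a b 1)) 0)
      + \<i> * complex_of_real (deriv (\<lambda>t::real. f (V + t *\<^sub>R entry_unit l k a b \<i>)) 0)) / 2)"

end

(* A self-adjoint change of coordinates S with S S = K turns the surrogate, by completing the square,
   into a constant minus |S V - inv S B|^2. Maximizing it over the closed convex feasible set is
   therefore the same as projecting inv S B onto the image of that set, and inv S B is the current
   iterate S Vt plus the gradient of the transformed objective. All matrix traces are handled as the
   real inner product Re tr(A^H B). *)
theory Submission
  imports Defs
begin

section \<open>The real trace inner product on complex matrices\<close>

lemma ctranspose_nth [simp]: "(A\<^sup>H) $ i $ j = cnj (A $ j $ i)"
  by (simp add: ctranspose_def)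

lemma ctranspose_ctranspose [simp]: "(A\<^sup>H)\<^sup>H = A"
  by (simp add: vec_eq_iff)

lemma ctranspose_mult: "(A ** B)\<^sup>H = B\<^sup>H ** A\<^sup>H"
  by (simp add: vec_eq_iff matrix_matrix_mult_def mult.commute)

lemma ctranspose_diff: "(A - B)\<^sup>H = A\<^sup>H - B\<^sup>H"
  by (simp add: vec_eq_iff)

lemma ctranspose_diag_mat [simp]: "(diag_mat f)\<^sup>H = diag_mat f"
  by (simp add: vec_eq_iff diag_mat_def)

lemma matrix_mult_diff_right: "A ** (B - C) = A ** B - A ** C"
  for A :: "('m::finite, 'n::finite) cmat"
  by (simp add: vec_eq_iff matrix_matrix_mult_def algebra_simps sum_subtractf)

lemma matrix_mult_diff_left: "(A - B) ** C = A ** C - B ** C"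
  for A :: "('m::finite, 'n::finite) cmat"
  by (simp add: vec_eq_iff matrix_matrix_mult_def algebra_simps sum_subtractf)

lemma matrix_mult_scaleR_right: "A ** (c *\<^sub>R B) = c *\<^sub>R (A ** B)"
  for A :: "('m::finite, 'n::finite) cmat"
  by (simp add: vec_eq_iff matrix_matrix_mult_def scaleR_sum_right)

lemma inner_complex_eq_Re: "x \<bullet> y = Re (cnj x * y)" for x y :: complex
  by (simp add: inner_complex_def)

text \<open>The inner product on nested vectors sums over rows first, the trace over columns first;
  exchanging the sums reconciles them. This gives the trace expressions access to the Euclidean
  theory of norms, convexity and projection.\<close>

lemma inner_eq_Re_trace: "A \<bullet> B = Re (trace (A\<^sup>H ** B))"
  for A B :: "('m::finite, 'n::finite) cmat"
  unfolding inner_vec_def trace_def matrix_matrix_mult_def inner_complex_eq_Re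
  by (simp, rule sum.swap)

lemma inner_matrix_mult: "A \<bullet> (M ** B) = (M\<^sup>H ** A) \<bullet> B"
  for B :: "('m::finite, 'n::finite) cmat"
  by (simp add: inner_eq_Re_trace ctranspose_mult matrix_mul_assoc)

lemma inner_ctranspose: "A\<^sup>H \<bullet> B\<^sup>H = A \<bullet> B"
  for A B :: "('m::finite, 'n::finite) cmat"
  unfolding inner_vec_def by (subst sum.swap) (simp add: inner_complex_def)

lemma inner_matrix_vector_mult: "x \<bullet> (M *v y) = (M\<^sup>H *v x) \<bullet> y"
  for x :: "(complex, 'm::finite) vec" and y :: "(complex, 'n::finite) vec"
proof -
  have "x \<bullet> (M *v y) = (\<Sum>i\<in>UNIV. \<Sum>j\<in>UNIV. Re (cnj (x $ i) * (M $ i $ j * y $ j)))"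
    by (simp add: inner_vec_def inner_complex_eq_Re matrix_vector_mult_def sum_distrib_left del: times_complex.sel)
  also have "\<dots> = (\<Sum>j\<in>UNIV. \<Sum>i\<in>UNIV. Re (cnj (x $ i) * (M $ i $ j * y $ j)))"
    by (rule sum.swap)
  also have "\<dots> = (M\<^sup>H *v x) \<bullet> y"
    by (simp add: inner_vec_def inner_complex_eq_Re matrix_vector_mult_def sum_distrib_left
        sum_distrib_right mult_ac del: times_complex.sel)
  finally show ?thesis .
qed

lemma Re_quad_form: "Re (quad_form A x) = x \<bullet> (A *v x)"
  by (simp add: quad_form_def inner_vec_def inner_complex_eq_Re del: times_complex.sel)

text \<open>Left multiplication acts on each column separately, so definiteness, which is stated for
  vectors, carries over to matrix arguments.\<close>

lemma inner_matrix_columns: "A \<bullet> (M ** A) = (\<Sum>j\<in>UNIV. column j A \<bullet> (M *v column j A))"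
  for A :: "('m::finite, 'n::finite) cmat"
  unfolding inner_vec_def
  by (subst sum.swap) (simp add: column_def matrix_matrix_mult_def matrix_vector_mult_def)

section \<open>Positive semidefinite square roots\<close>

lemma pos_def_imp_psd: "pos_def A \<Longrightarrow> psd A"
  unfolding pos_def_def psd_def
  by (metis Re_quad_form inner_zero_left less_eq_real_def)

lemma psd_inner_nonneg: "psd A \<Longrightarrow> 0 \<le> X \<bullet> (A ** X)"
  unfolding inner_matrix_columns psd_def Re_quad_form by (simp add: sum_nonneg)

text \<open>Every column contributes a nonnegative term, so a vanishing total makes each term
  vanish, and definiteness then kills each column.\<close>

lemma pos_def_inner_eq_0:
  fixes X :: "('n::finite, 'm::finite) cmat"
  assumes "pos_def A" "X \<bullet> (A ** X) = 0"
  shows "X = 0"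
proof -
  have nn: "0 \<le> column j X \<bullet> (A *v column j X)" for j
    using pos_def_imp_psd[OF assms(1)] by (simp add: psd_def Re_quad_form)
  have "column j X \<bullet> (A *v column j X) = 0" for j
    using assms(2) nn unfolding inner_matrix_columns by (subst (asm) sum_nonneg_eq_0_iff) auto
  then have "column j X = 0" for j
    using assms(1) unfolding pos_def_def Re_quad_form by (metis less_irrefl)
  then show ?thesis by (simp add: vec_eq_iff column_def)
qed

text \<open>For \<open>X = S - T\<close> one has \<open>S X + X T = 0\<close>. Pairing with \<open>X\<close> gives two nonnegative terms that
  sum to zero.\<close>

lemma psd_square_root_unique:
  assumes "psd S" "pos_def T" "S ** S = T ** T"
  shows "S = T"
proof -
  define X where "X = S - T"
  have herm: "S\<^sup>H = S" "T\<^sup>H = T"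
    using assms by (auto simp: psd_def pos_def_def hermitian_def)
  then have XH: "X\<^sup>H = X" by (simp add: X_def ctranspose_diff)
  have "S ** X + X ** T = 0"
    using assms(3) by (simp add: X_def matrix_mult_diff_right matrix_mult_diff_left)
  then have "X \<bullet> (S ** X) + X \<bullet> (X ** T) = 0"
    by (metis inner_add_right inner_zero_right)
  \<comment> \<open>Conjugate transposition preserves the inner product and, all factors being
    Hermitian, turns \<open>X ** T\<close> into \<open>T ** X\<close>, to which positivity of
    \<open>T\<close> applies.\<close>
  moreover have "X \<bullet> (X ** T) = X \<bullet> (T ** X)"
    by (metis XH herm(2) ctranspose_mult inner_ctranspose)
  ultimately have "X \<bullet> (T ** X) = 0"
    using psd_inner_nonneg[OF assms(1), of X] psd_inner_nonneg[OF pos_def_imp_psd[OF assms(2)], of X]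
    by linarith
  then show ?thesis using pos_def_inner_eq_0[OF assms(2)] X_def by force
qed

text \<open>\<open>psd_sqrt\<close> is a definite description, so a candidate root can be identified
  with it only through uniqueness among all psd roots.\<close>

lemma psd_sqrt_eqI: "pos_def T \<Longrightarrow> T ** T = A \<Longrightarrow> psd_sqrt A = T"
  unfolding psd_sqrt_def
  by (rule the_equality) (auto intro: pos_def_imp_psd psd_square_root_unique)

section \<open>Calculus of matrices diagonalized by a unitary\<close>

lemma diag_mat_mult: "diag_mat f ** diag_mat g = diag_mat (\<lambda>i. f i * g i)"
  by (simp add: vec_eq_iff matrix_matrix_mult_def diag_mat_def if_distrib [where f = "\<lambda>x. x * _"]
      cong: if_cong)

lemma diag_mat_vector_mult_nth: "(diag_mat f *v y) $ i = f i *\<^sub>R y $ i"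
  by (simp add: matrix_vector_mult_def diag_mat_def if_distrib [where f = "\<lambda>x. x * _"] scaleR_conv_of_real
      cong: if_cong)

lemma inner_diag_mat: "y \<bullet> (diag_mat f *v y) = (\<Sum>i\<in>UNIV. f i * (norm (y $ i))\<^sup>2)"
  by (simp add: inner_vec_def diag_mat_vector_mult_nth power2_norm_eq_inner)

lemma inner_unitary_diag:
  "x \<bullet> ((U ** diag_mat f ** U\<^sup>H) *v x) = (\<Sum>i\<in>UNIV. f i * (norm ((U\<^sup>H *v x) $ i))\<^sup>2)"
  by (simp flip: inner_diag_mat add: inner_matrix_vector_mult matrix_vector_mul_assoc[symmetric])

lemma hermitian_unitary_diag: "hermitian (U ** diag_mat f ** U\<^sup>H)"
  by (simp add: hermitian_def ctranspose_mult matrix_mul_assoc)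

text \<open>In the coordinates \<open>U\<^sup>H *v x\<close> the form is a sum of squared moduli
  weighted by \<open>f\<close>. One direction extracts positive eigenvalues from a definite matrix,
  the other certifies that the root built from them is definite.\<close>

lemma pos_def_unitary_diag_iff:
  assumes "unitary U"
  shows "pos_def (U ** diag_mat f ** U\<^sup>H) \<longleftrightarrow> (\<forall>i. 0 < f i)"
proof
  assume pd: "pos_def (U ** diag_mat f ** U\<^sup>H)"
  show "\<forall>i. 0 < f i"
  proof
    fix i
    \<comment> \<open>The eigenvector for \<open>f i\<close>: in rotated coordinates it is a unit
      vector, which isolates that single weight.\<close>
    define x where "x = U *v axis i 1"
    have x: "U\<^sup>H *v x = axis i 1"
      using assms by (simp add: x_def matrix_vector_mul_assoc unitary_def)
    then have "x \<noteq> 0" by (metis axis_eq_0_iff matrix_vector_mult_0_right one_neq_zero)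
    with pd have "0 < x \<bullet> ((U ** diag_mat f ** U\<^sup>H) *v x)"
      by (simp add: pos_def_def Re_quad_form)
    also have "\<dots> = (\<Sum>j\<in>UNIV. if j = i then f j else 0)"
      unfolding inner_unitary_diag x by (rule sum.cong) (auto simp: axis_def)
    finally show "0 < f i" by simp
  qed
next
  assume f: "\<forall>i. 0 < f i"
  show "pos_def (U ** diag_mat f ** U\<^sup>H)"
    unfolding pos_def_def Re_quad_form
  proof (intro conjI allI impI)
    show "hermitian (U ** diag_mat f ** U\<^sup>H)"
      by (rule hermitian_unitary_diag)
    fix x :: "(complex, 'a) vec" assume "x \<noteq> 0"
    moreover have "x = U *v (U\<^sup>H *v x)"
      using assms by (simp add: matrix_vector_mul_assoc unitary_def)
    ultimately have "U\<^sup>H *v x \<noteq> 0" by (metis matrix_vector_mult_0_right)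
    then obtain i where "(U\<^sup>H *v x) $ i \<noteq> 0" by (auto simp: vec_eq_iff)
    then show "0 < x \<bullet> ((U ** diag_mat f ** U\<^sup>H) *v x)"
      unfolding inner_unitary_diag using f by (intro sum_pos2[where i = i]) (auto simp: less_imp_le)
  qed
qed

lemma unitary_diag_mult:
  assumes "unitary U"
  shows "(U ** diag_mat f ** U\<^sup>H) ** (U ** diag_mat g ** U\<^sup>H) = U ** diag_mat (\<lambda>i. f i * g i) ** U\<^sup>H"
proof -
  have "(U ** diag_mat f ** U\<^sup>H) ** (U ** diag_mat g ** U\<^sup>H)
      = U ** diag_mat f ** (U\<^sup>H ** U) ** diag_mat g ** U\<^sup>H"
    by (simp add: matrix_mul_assoc)
  also have "\<dots> = U ** (diag_mat f ** diag_mat g) ** U\<^sup>H"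
    using assms by (simp add: unitary_def matrix_mul_assoc)
  finally show ?thesis by (simp add: diag_mat_mult)
qed

text \<open>\<open>matrix_inv\<close> is a choice among two-sided inverses; exhibiting one makes the
  choice meaningful, and associativity makes it unique.\<close>

lemma matrix_inv_eqI:
  fixes A :: "('n::finite, 'n) cmat"
  assumes "A ** B = mat 1" "B ** A = mat 1"
  shows "matrix_inv A = B"
proof -
  have "A ** matrix_inv A = mat 1 \<and> matrix_inv A ** A = mat 1"
    unfolding matrix_inv_def by (rule someI[of _ B]) (use assms in simp)
  then show ?thesis using assms by (metis matrix_mul_assoc matrix_mul_rid)
qed

lemma diag_mat_1: "diag_mat (\<lambda>i. 1) = mat 1"
  by (simp add: vec_eq_iff diag_mat_def mat_def)

text \<open>With \<open>U\<close> fixed, the map from \<open>g\<close> to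
  \<open>U ** diag_mat g ** U\<^sup>H\<close> is multiplicative. Roots and inverses thus reduce to
  \<open>sqrt (f i)\<close> and reciprocals of positive reals.\<close>

lemma psd_sqrt_unitary_diag:
  assumes U: "unitary U" and pd: "pos_def (U ** diag_mat f ** U\<^sup>H)"
  defines "K \<equiv> U ** diag_mat f ** U\<^sup>H"
  shows psd_sqrt_hermitian: "(psd_sqrt K)\<^sup>H = psd_sqrt K"
    and psd_sqrt_square: "psd_sqrt K ** psd_sqrt K = K"
    and psd_sqrt_inv_right: "psd_sqrt K ** matrix_inv (psd_sqrt K) = mat 1"
    and psd_sqrt_inv_left: "matrix_inv (psd_sqrt K) ** psd_sqrt K = mat 1"
    and psd_sqrt_inv_hermitian: "(matrix_inv (psd_sqrt K))\<^sup>H = matrix_inv (psd_sqrt K)"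
    and matrix_inv_eq_psd_sqrt: "matrix_inv K = matrix_inv (psd_sqrt K) ** matrix_inv (psd_sqrt K)"
proof -
  have f: "\<And>i. 0 < f i" using pd pos_def_unitary_diag_iff[OF U] by blast
  define M where "M g = U ** diag_mat g ** U\<^sup>H" for g
  have M: "M g ** M h = M (\<lambda>i. g i * h i)" for g h
    unfolding M_def by (rule unitary_diag_mult[OF U])
  have M1: "M g = mat 1" if "g = (\<lambda>i. 1)" for g
    using U by (simp add: that M_def diag_mat_1 unitary_def)
  define s where "s i = sqrt (f i)" for i
  have s: "0 < s i" "s i * s i = f i" for i using f[of i] by (auto simp: s_def)
  have s0: "s i \<noteq> 0" for i using s(1)[of i] by simp
  have sq: "psd_sqrt K = M s"
  proof (rule psd_sqrt_eqI)
    show "pos_def (M s)" using s(1) by (simp add: M_def pos_def_unitary_diag_iff[OF U])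
    show "M s ** M s = K" unfolding M by (simp add: s K_def M_def)
  qed
  have inv: "matrix_inv (M g) = M (\<lambda>i. inverse (g i))" if "\<And>i. g i \<noteq> 0" for g
    by (rule matrix_inv_eqI; unfold M; rule M1) (use that in \<open>auto simp: fun_eq_iff\<close>)
  have K: "K = M f" by (simp add: K_def M_def)
  have herm: "(M g)\<^sup>H = M g" for g
    using hermitian_unitary_diag by (simp add: M_def hermitian_def)
  show "(psd_sqrt K)\<^sup>H = psd_sqrt K" by (simp add: sq herm)
  show "psd_sqrt K ** psd_sqrt K = K" by (simp add: sq M s(2)) (simp add: K)
  show "psd_sqrt K ** matrix_inv (psd_sqrt K) = mat 1"
    unfolding sq inv[OF s0] M by (rule M1) (simp add: s0 fun_eq_iff)
  show "matrix_inv (psd_sqrt K) ** psd_sqrt K = mat 1"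
    unfolding sq inv[OF s0] M by (rule M1) (simp add: s0 fun_eq_iff)
  show "(matrix_inv (psd_sqrt K))\<^sup>H = matrix_inv (psd_sqrt K)"
    unfolding sq inv[OF s0] by (rule herm)
  have "f i \<noteq> 0" for i using f[of i] by simp
  then have "matrix_inv K = M (\<lambda>i. inverse (f i))"
    unfolding K by (rule inv)
  also have "\<dots> = M (\<lambda>i. inverse (s i)) ** M (\<lambda>i. inverse (s i))"
    unfolding M by (simp flip: s(2))
  finally show "matrix_inv K = matrix_inv (psd_sqrt K) ** matrix_inv (psd_sqrt K)"
    unfolding sq inv[OF s0] .
qed

section \<open>Blockwise operators and quadratic objectives\<close>

text \<open>All users of a cell share one matrix. Viewing the family as a single linear operator on
  tuples lets the objectives be treated as quadratic functions on one Euclidean space.\<close>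

definition block_mult ::
  "('l::finite \<Rightarrow> ('nt::finite, 'nt) cmat) \<Rightarrow>
   ('l, 'k::finite, 'nt, 'd::finite) blocks \<Rightarrow> ('l, 'k, 'nt, 'd) blocks"
  where "block_mult M V = (\<chi> l k. M l ** (V $ l $ k))"

lemma block_mult_nth [simp]: "block_mult M V $ l $ k = M l ** (V $ l $ k)"
  by (simp add: block_mult_def)

lemma change_coord_eq_block_mult: "change_coord K = block_mult (\<lambda>l. psd_sqrt (K l))"
  by (simp add: fun_eq_iff change_coord_def block_mult_def)

lemma linear_block_mult: "linear (block_mult M)"
  by (rule linearI) (simp_all add: vec_eq_iff block_mult_def
      matrix_add_ldistrib matrix_mult_scaleR_right)

lemma block_mult_cancel:
  "(\<And>l. M l ** N l = mat 1) \<Longrightarrow> block_mult M (block_mult N V) = V"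
  by (simp add: block_mult_def matrix_mul_assoc)

lemma inner_blocks: "V \<bullet> W = (\<Sum>l\<in>UNIV. \<Sum>k\<in>UNIV. V $ l $ k \<bullet> W $ l $ k)"
  for V W :: "('l::finite, 'k::finite, 'nt::finite, 'd::finite) blocks"
  by (simp add: inner_vec_def[where 'b = 'l] inner_vec_def[where 'b = 'k])

lemma inner_block_mult:
  assumes "\<And>l. (M l)\<^sup>H = M l"
  shows "V \<bullet> block_mult M W = block_mult M V \<bullet> W"
  by (simp add: inner_blocks inner_matrix_mult assms)

lemma surrogate_eq:
  "surrogate Lam L K c Vt V =
     2 * (V \<bullet> (\<chi> l k. B_mat Lam L K Vt l k)) - V \<bullet> block_mult K V + c"
  by (simp add: surrogate_def inner_blocks inner_eq_Re_trace matrix_mul_assoc sum_distrib_left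
      sum_subtractf)

lemma transformed_objective_eq:
  "transformed_objective Lam L K c V =
     2 * (V \<bullet> (\<chi> l k. matrix_inv (psd_sqrt (K l)) ** Lam l k))
     - V \<bullet> block_mult (\<lambda>l. matrix_inv (psd_sqrt (K l)) ** L l ** matrix_inv (psd_sqrt (K l))) V + c"
  by (simp add: transformed_objective_def inner_blocks inner_eq_Re_trace matrix_mul_assoc
      sum_distrib_left sum_subtractf)

section \<open>Conjugate gradient of a quadratic objective\<close>

lemma inner_entry_unit: "entry_unit l k a b z \<bullet> V = Re (cnj z * V $ l $ k $ a $ b)"
  by (simp add: entry_unit_def inner_axis' inner_complex_eq_Re)

text \<open>The real directional derivative along \<open>E\<close> is twice
  \<open>E \<bullet> (A - T V)\<close>. The directions \<open>1\<close> and \<open>\<i>\<close> at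
  an entry read off its real and imaginary parts, and the half in the Wirtinger derivative cancels
  the two; this is why the step size is exactly one.\<close>

lemma wirtinger_conj_quadratic:
  assumes T: "linear T" and adj: "\<And>V W. V \<bullet> T W = T V \<bullet> W"
  shows "wirtinger_conj (\<lambda>V. 2 * (V \<bullet> A) - V \<bullet> T V + c) V = A - T V"
proof -
  let ?f = "\<lambda>V. 2 * (V \<bullet> A) - V \<bullet> T V + c"
  \<comment> \<open>The expansion in \<open>t\<close> is exact; self-adjointness of \<open>T\<close>
    merges the two cross terms.\<close>
  have "?f (V + t *\<^sub>R E) = ?f V + 2 * t * (E \<bullet> (A - T V)) - t\<^sup>2 * (E \<bullet> T E)" for t E
    by (simp add: linear_add[OF T] linear_scale[OF T] inner_add_left inner_add_right
        inner_diff_right adj inner_commute[of "T V" E] algebra_simps power2_eq_square)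
  then have "deriv (\<lambda>t. ?f (V + t *\<^sub>R E)) 0 = 2 * (E \<bullet> (A - T V))" for E
    by (intro DERIV_imp_deriv) (auto intro!: derivative_eq_intros)
  then show ?thesis
    by (simp add: vec_eq_iff wirtinger_conj_def inner_entry_unit complex_eq_iff)
qed

section \<open>Constrained maximization as projection\<close>

text \<open>A larger value of \<open>f\<close> means a smaller distance from \<open>S V\<close> to
  \<open>a\<close>, and injectivity of \<open>S\<close> transfers membership in \<open>C\<close> to
  its image. The image stays closed and convex, so its nearest point exists and is unique.\<close>

lemma is_arg_max_iff_closest_point:
  fixes S :: "'a::euclidean_space \<Rightarrow> 'a"
  assumes S: "linear S" "inj S" and C: "convex C" "closed C" "C \<noteq> {}"
    and f: "\<And>V. f V = c - (norm (S V - a))\<^sup>2"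
  shows "is_arg_max f (\<lambda>W. W \<in> C) V \<longleftrightarrow> S V = closest_point (S ` C) a"
proof -
  have conv: "convex (S ` C)" using S C by (intro convex_linear_image)
  have cl: "closed (S ` C)" using S C by (intro closed_injective_linear_image)
  have le: "f V \<le> f W \<longleftrightarrow> dist a (S W) \<le> dist a (S V)" for V W
    by (simp add: f dist_norm norm_minus_commute)
  have "is_arg_max f (\<lambda>W. W \<in> C) V \<longleftrightarrow> V \<in> C \<and> (\<forall>W\<in>C. f W \<le> f V)"
    by (auto simp: is_arg_max_def not_less)
  also have "\<dots> \<longleftrightarrow> S V \<in> S ` C \<and> (\<forall>y\<in>S ` C. dist a (S V) \<le> dist a y)"
    using S(2) by (auto simp: le inj_image_mem_iff)
  \<comment> \<open>Uniqueness identifies any minimizer with \<open>closest_point\<close>; existence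
    shows that \<open>closest_point\<close> is a minimizer.\<close>
  also have "\<dots> \<longleftrightarrow> S V = closest_point (S ` C) a"
    using closest_point_unique[OF conv cl] closest_point_exists[OF cl] C(3)
    by (metis image_is_empty)
  finally show ?thesis .
qed

section \<open>Geometry of the feasible set and its image\<close>

text \<open>Each power budget bounds the joint norm of one cell, so the set is an intersection of
  preimages of balls under linear coordinate maps.\<close>

lemma convex_feasible:
  "convex (feasible P :: ('l::finite, 'k::finite, 'nt::finite, 'd::finite) blocks set)"
proof -
  \<comment> \<open>The real \<open>sqrt\<close> is odd and strictly monotone on the whole line, so
    for negative \<open>p\<close> both sides are false.\<close>
  have sq: "x\<^sup>2 \<le> p \<longleftrightarrow> x \<le> sqrt p" if "0 \<le> x" for x p :: real
    using real_sqrt_le_iff[of "x\<^sup>2" p] that by simp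
  have "(\<Sum>k\<in>UNIV. (norm (V $ l $ k))\<^sup>2) = (norm (V $ l))\<^sup>2"
    for l and V :: "('l, 'k, 'nt, 'd) blocks"
    by (simp add: norm_vec_def[of "V $ l"] L2_set_def sum_nonneg)
  then have "(feasible P :: ('l, 'k, 'nt, 'd) blocks set)
      = (\<Inter>l. (\<lambda>V. V $ l) -` cball 0 (sqrt (P l)))"
    by (auto simp: feasible_def sq)
  then show ?thesis
    by (simp only:) (intro convex_INT convex_linear_vimage convex_cball bounded_linear.linear bounded_linear_vec_nth)
qed

lemma closed_feasible: "closed (feasible P)"
  unfolding feasible_def
  by (intro closed_Collect_all closed_Collect_le continuous_intros)

text \<open>The weight \<open>matrix_inv (K l)\<close> splits into two inverse roots, each
  cancelling one factor \<open>psd_sqrt (K l)\<close>, which leaves the squared Frobenius norm of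
  the original block. Surjectivity, by the inverse root, then yields equality of the sets.\<close>

lemma change_coord_image_feasible:
  fixes K :: "'l::finite \<Rightarrow> ('nt::finite, 'nt) cmat"
  assumes "\<And>l. (psd_sqrt (K l))\<^sup>H = psd_sqrt (K l)"
    and inv: "\<And>l. psd_sqrt (K l) ** matrix_inv (psd_sqrt (K l)) = mat 1"
      "\<And>l. matrix_inv (psd_sqrt (K l)) ** psd_sqrt (K l) = mat 1"
    and K: "\<And>l. matrix_inv (K l) = matrix_inv (psd_sqrt (K l)) ** matrix_inv (psd_sqrt (K l))"
  shows "change_coord K ` (feasible P :: ('l, 'k::finite, 'nt, 'd::finite) blocks set)
    = transformed_feasible K P"
proof -
  have "Re (trace ((psd_sqrt (K l) ** A)\<^sup>H ** matrix_inv (K l) ** (psd_sqrt (K l) ** A))) = (norm A)\<^sup>2"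
    for l and A :: "('nt, 'd) cmat"
  proof -
    let ?S = "psd_sqrt (K l)" and ?R = "matrix_inv (psd_sqrt (K l))"
    have "(?S ** A)\<^sup>H ** matrix_inv (K l) ** (?S ** A) = A\<^sup>H ** (?S ** ?R) ** (?R ** ?S) ** A"
      by (simp add: K ctranspose_mult assms(1) matrix_mul_assoc)
    then show ?thesis
      by (simp add: inv power2_norm_eq_inner inner_eq_Re_trace)
  qed
  then have iff: "change_coord K V \<in> transformed_feasible K P \<longleftrightarrow> V \<in> feasible P"
    for V :: "('l, 'k, 'nt, 'd) blocks"
    by (simp add: transformed_feasible_def feasible_def change_coord_def)
  have surj: "change_coord K (block_mult (\<lambda>l. matrix_inv (psd_sqrt (K l))) W) = W"
    for W :: "('l, 'k, 'nt, 'd) blocks"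
    unfolding change_coord_eq_block_mult by (rule block_mult_cancel) (rule inv(1))
  show ?thesis
  proof (intro subset_antisym subsetI)
    fix W :: "('l, 'k, 'nt, 'd) blocks"
    assume "W \<in> transformed_feasible K P"
    then have "block_mult (\<lambda>l. matrix_inv (psd_sqrt (K l))) W \<in> feasible P"
      by (simp add: surj flip: iff)
    then show "W \<in> change_coord K ` feasible P"
      by (rule rev_image_eqI) (simp add: surj)
  qed (use iff in auto)
qed

section \<open>Surrogate maximization as a projected gradient step\<close>

theorem mainTheorem6:
  fixes w :: "'l::finite \<Rightarrow> 'k::finite \<Rightarrow> real"
    and H :: "'l \<Rightarrow> 'k \<Rightarrow> 'l \<Rightarrow> ('nr::finite, 'nt::{finite,linorder}) cmat"
    and Y :: "'l \<Rightarrow> 'k \<Rightarrow> ('nr, 'd::finite) cmat"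
    and \<Gamma> :: "'l \<Rightarrow> 'k \<Rightarrow> ('d, 'd) cmat"
    and P :: "'l \<Rightarrow> real"
    and U :: "'l \<Rightarrow> ('nt, 'nt) cmat"
    and lam :: "'l \<Rightarrow> nat \<Rightarrow> real"
    and r :: nat
    and c\<^sub>s c\<^sub>q :: real
    and Vt :: "('l, 'k, 'nt, 'd) blocks"
    and \<Lambda> :: "'l \<Rightarrow> 'k \<Rightarrow> ('nt, 'd) cmat"
    and L K :: "'l \<Rightarrow> ('nt, 'nt) cmat"
  defines "\<Lambda> \<equiv> Lambda_mat w H Y \<Gamma>"
    and "L \<equiv> L_mat w H Y \<Gamma>"
    and "K \<equiv> (\<lambda>l. K_mat (U l) (lam l) r)"
  assumes "\<And>l. 0 \<le> P l"
    and "\<And>l k. 0 \<le> w l k"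
    and "\<And>l k. psd (\<Gamma> l k)"
    and "\<And>l. eig_decomp (L l) (U l) (lam l)"
    and "r \<le> CARD('nt) - 1"
    and "\<And>l. pos_def (K l)"
    and "Vt \<in> feasible P"
  shows "bij (change_coord K :: ('l, 'k, 'nt, 'd) blocks \<Rightarrow> ('l, 'k, 'nt, 'd) blocks) \<and>
    bij_betw (change_coord K) (feasible P :: ('l, 'k, 'nt, 'd) blocks set)
      (transformed_feasible K P) \<and>
    (\<forall>V. is_arg_max (surrogate \<Lambda> L K c\<^sub>s Vt) (\<lambda>W. W \<in> feasible P) V \<longleftrightarrow>
       change_coord K V =
         closest_point (transformed_feasible K P)
           (change_coord K Vt
            + wirtinger_conj (transformed_objective \<Lambda> L K c\<^sub>q) (change_coord K Vt))) \<and>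
    (\<forall>l k. (change_coord K Vt
            + wirtinger_conj (transformed_objective \<Lambda> L K c\<^sub>q) (change_coord K Vt)) $ l $ k
         = matrix_inv (psd_sqrt (K l)) ** B_mat \<Lambda> L K Vt l k)"
proof -
  define S where "S l = psd_sqrt (K l)" for l
  define R where "R l = matrix_inv (S l)" for l
  \<comment> \<open>\<open>K l\<close> is diagonal in the eigenbasis of \<open>L l\<close>, with the
    eigenvalues after position \<open>r\<close> flattened to \<open>lam l (r + 1)\<close>, so the
    root calculus applies to it.\<close>
  note sqrt_facts = psd_sqrt_unitary_diag[where U = "U l" and
      f = "\<lambda>i. if pos i \<le> r then lam l (pos i) else lam l (r + 1)" for l]
  have U: "unitary (U l)" for l using assms(7)[of l] by (simp add: eig_decomp_def)
  have K_eq: "K l = U l ** diag_mat (\<lambda>i. if pos i \<le> r then lam l (pos i) else lam l (r + 1)) ** (U l)\<^sup>H"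
    for l by (simp add: K_def K_mat_def)
  note sqrt_K = sqrt_facts[OF U, folded K_eq, OF assms(9)]
  have SH: "(S l)\<^sup>H = S l" and SS: "S l ** S l = K l" and SR: "S l ** R l = mat 1"
    and RS: "R l ** S l = mat 1" and RH: "(R l)\<^sup>H = R l" for l
    using sqrt_K[of l] by (simp_all add: S_def R_def)
  \<comment> \<open>Self-adjointness is read off the eigendecomposition, whose diagonal is real,
    instead of the defining sum.\<close>
  have LH: "(L l)\<^sup>H = L l" for l
    using assms(7)[of l] hermitian_unitary_diag unfolding eig_decomp_def hermitian_def by metis
  have cc: "change_coord K = block_mult S"
    unfolding change_coord_eq_block_mult S_def ..
  have bij: "bij (change_coord K :: ('l, 'k, 'nt, 'd) blocks \<Rightarrow> _)"
    unfolding cc by (rule o_bij[where g = "block_mult R"])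
      (simp_all add: fun_eq_iff block_mult_cancel SR RS)
  have img: "change_coord K ` (feasible P :: ('l, 'k, 'nt, 'd) blocks set) = transformed_feasible K P"
    by (rule change_coord_image_feasible) (rule sqrt_K)+
  define B :: "('l, 'k, 'nt, 'd) blocks" where "B = (\<chi> l k. B_mat \<Lambda> L K Vt l k)"
  define a where "a = change_coord K Vt
            + wirtinger_conj (transformed_objective \<Lambda> L K c\<^sub>q) (change_coord K Vt)"
  \<comment> \<open>At \<open>S Vt\<close> the gradient block is
    \<open>R (\<Lambda> - L Vt)\<close>, because \<open>R S = 1\<close>. Since
    \<open>K = S S\<close>, the iterate block itself is \<open>R (K Vt)\<close>, and the sum is
    \<open>R\<close> applied to \<open>B_mat\<close>.\<close>
  have a: "a $ l $ k = R l ** B_mat \<Lambda> L K Vt l k" for l k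
  proof -
    have "wirtinger_conj (transformed_objective \<Lambda> L K c\<^sub>q) V
        = (\<chi> l k. R l ** \<Lambda> l k) - block_mult (\<lambda>l. R l ** L l ** R l) V" for V
      unfolding transformed_objective_eq S_def[symmetric] R_def[symmetric]
      by (intro wirtinger_conj_quadratic linear_block_mult inner_block_mult)
        (simp add: ctranspose_mult RH LH matrix_mul_assoc)
    then have "a $ l $ k = S l ** (Vt $ l $ k)
        + (R l ** \<Lambda> l k - R l ** L l ** (R l ** S l) ** (Vt $ l $ k))"
      by (simp add: a_def cc matrix_mul_assoc)
    moreover have "R l ** (K l ** (Vt $ l $ k)) = S l ** (Vt $ l $ k)"
      by (metis RS SS matrix_mul_assoc matrix_mul_lid)
    ultimately show ?thesis
      by (simp add: B_mat_def RS matrix_add_ldistrib matrix_mult_diff_left matrix_mult_diff_right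
          matrix_mul_assoc)
  qed
  then have aB: "a = block_mult R B" by (simp add: vec_eq_iff B_def)
  \<comment> \<open>Completing the square: \<open>S S = K\<close> gives the quadratic term, and
    \<open>S a = B\<close> with \<open>S\<close> self-adjoint gives the linear one.\<close>
  have "surrogate \<Lambda> L K c\<^sub>s Vt V = (c\<^sub>s + (norm a)\<^sup>2) - (norm (change_coord K V - a))\<^sup>2" for V
  proof -
    have "block_mult S V \<bullet> block_mult S V = V \<bullet> block_mult K V"
      by (simp add: inner_block_mult[OF SH, symmetric]) (simp add: block_mult_def matrix_mul_assoc SS)
    moreover have "block_mult S V \<bullet> a = V \<bullet> B"
      by (simp add: aB inner_block_mult[OF SH, symmetric] block_mult_cancel SR)
    ultimately show ?thesis
      by (simp add: surrogate_eq B_def[symmetric] cc power2_norm_eq_inner inner_diff_left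
          inner_diff_right inner_commute[of a "block_mult S V"])
  qed
  \<comment> \<open>The current iterate \<open>Vt\<close> witnesses that the feasible set is
    nonempty, so the projection is well defined.\<close>
  then have "is_arg_max (surrogate \<Lambda> L K c\<^sub>s Vt) (\<lambda>W. W \<in> feasible P) V \<longleftrightarrow>
      change_coord K V = closest_point (transformed_feasible K P) a" for V
    unfolding img[symmetric]
    by (intro is_arg_max_iff_closest_point convex_feasible closed_feasible)
      (use bij assms(10) linear_block_mult in \<open>auto simp: bij_is_inj cc\<close>)
  moreover have "bij_betw (change_coord K) (feasible P :: ('l, 'k, 'nt, 'd) blocks set)
      (transformed_feasible K P)"
    using bij img by (metis bij_betw_imageI bij_is_inj inj_on_subset subset_UNIV)
  ultimately show ?thesis
    using bij a unfolding a_def R_def S_def by blast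
qed

end
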